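(* Let $S$ be a subsemigroup of the bicyclic monoid $\mathcal{B}$. If $S$ is a left I-order in $\mathcal{B}$, then $S$ is a straight left I-order in $\mathcal{B}$.
   Context: The bicyclic monoid $\mathcal{B}$ is the monoid generated by $a,b$ subject to $ba=1$; its elements are uniquely of the form $a^ib^j$ with $i,j\ge 0$, with $a^kb^l\,a^mb^n=a^{k-l+t}b^{n-m+t}$ where $t=\max\{l,m\}$. It is an inverse monoid with $(a^ib^j)^{-1}=a^jb^i$, and Green's relation $\mathcal{R}$ is given by $a^ib^j\,\mathcal{R}\,a^kb^l$ iff $i=k$. A subsemigroup $S$ of an inverse semigroup $Q$ is a left I-order in $Q$ if every element of $Q$ can be written as $s^{-1}t$ with $s,t\in S$ (where $s^{-1}$ is the inverse of $s$ in $Q$ in the sense of inverse semigroup theory). It is a straight left I-order in $Q$ if every element of $Q$ can be written as $s^{-1}t$ with $s,t\in S$ and $s\,\mathcal{R}\,t$ in $Q$. *)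

theory Defs
  imports Main
begin

class inverse_semigroup = semigroup_mult +
  assumes ex1_inverse: "\<exists>!y. x * y * x = x \<and> y * x * y = y"

definition semigroup_inv :: "'a::inverse_semigroup \<Rightarrow> 'a" where
  "semigroup_inv x = (THE y. x * y * x = x \<and> y * x * y = y)"

lemma semigroup_inv_eqI:
  fixes x y :: "'a::inverse_semigroup"
  assumes "x * y * x = x" and "y * x * y = y"
  shows "semigroup_inv x = y"
  unfolding semigroup_inv_def
  using assms ex1_inverse[of x] by (intro the1_equality) auto

text \<open>The principal right ideal $xQ^1$; adjoining $x$ itself accounts for the
  identity of $Q^1$.\<close>
definition principal_right_ideal :: "'a::semigroup_mult \<Rightarrow> 'a set" where
  "principal_right_ideal x = insert x {x * q | q. True}"

definition green_R :: "'a::semigroup_mult \<Rightarrow> 'a \<Rightarrow> bool" where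
  "green_R x y \<longleftrightarrow> principal_right_ideal x = principal_right_ideal y"

text \<open>Nonemptiness is not required here; it follows for every left I-order, since a
  type is inhabited.\<close>
definition subsemigroup :: "'a::semigroup_mult set \<Rightarrow> bool" where
  "subsemigroup S \<longleftrightarrow> (\<forall>x\<in>S. \<forall>y\<in>S. x * y \<in> S)"

text \<open>In the next two definitions the inverse semigroup $Q$ is the whole type.\<close>
definition left_I_order :: "'a::inverse_semigroup set \<Rightarrow> bool" where
  "left_I_order S \<longleftrightarrow>
     subsemigroup S \<and> (\<forall>q. \<exists>s\<in>S. \<exists>t\<in>S. q = semigroup_inv s * t)"

definition straight_left_I_order :: "'a::inverse_semigroup set \<Rightarrow> bool" where
  "straight_left_I_order S \<longleftrightarrow>
     subsemigroup S \<and> (\<forall>q. \<exists>s\<in>S. \<exists>t\<in>S. green_R s t \<and> q = semigroup_inv s * t)"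

text \<open>The bicyclic monoid $\langle a, b \mid ba = 1\rangle$ in normal form:
  \<open>Bic i j\<close> stands for $a^i b^j$.\<close>
datatype bicyclic = Bic nat nat

instantiation bicyclic :: monoid_mult
begin

definition one_bicyclic :: bicyclic where
  "1 = Bic 0 0"

text \<open>The exponents are $k - l + t$ and $n - m + t$ with $t = \max\{l, m\}$, bracketed so
  that the subtraction on \<^typ>\<open>nat\<close> never truncates.\<close>
fun times_bicyclic :: "bicyclic \<Rightarrow> bicyclic \<Rightarrow> bicyclic" where
  "Bic k l * Bic m n = Bic (k + (max l m - l)) (n + (max l m - m))"

instance
proof
  fix x y z :: bicyclic
  show "x * y * z = x * (y * z)"
    by (cases x; cases y; cases z) (auto simp: max_def)
  show "1 * x = x" and "x * 1 = x"
    by (cases x; simp add: one_bicyclic_def)+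
qed

end

lemma Bic_inverse_iff:
  "Bic i j * Bic k l * Bic i j = Bic i j \<and> Bic k l * Bic i j * Bic k l = Bic k l
     \<longleftrightarrow> k = j \<and> l = i"
  by (auto simp: max_def split: if_splits)

instance bicyclic :: inverse_semigroup
proof
  fix x :: bicyclic
  obtain i j where x: "x = Bic i j" by (cases x)
  show "\<exists>!y. x * y * x = x \<and> y * x * y = y"
  proof (rule ex1I)
    show "x * Bic j i * x = x \<and> Bic j i * x * Bic j i = Bic j i"
      unfolding x Bic_inverse_iff by simp
  next
    fix y
    assume y: "x * y * x = x \<and> y * x * y = y"
    obtain k l where "y = Bic k l" by (cases y)
    with y show "y = Bic j i" unfolding x by (simp only: Bic_inverse_iff)
  qed
qed

lemma semigroup_inv_Bic [simp]: "semigroup_inv (Bic i j) = Bic j i"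
  using Bic_inverse_iff[of i j j i] by (intro semigroup_inv_eqI) blast+

lemma green_R_Bic [simp]: "green_R (Bic i j) (Bic k l) \<longleftrightarrow> i = k"
proof -
  have ideal: "principal_right_ideal (Bic m n) = {Bic p q | p q. m \<le> p}" for m n
  proof (intro set_eqI iffI)
    fix x assume "x \<in> principal_right_ideal (Bic m n)"
    then consider "x = Bic m n" | q where "x = Bic m n * q"
      by (auto simp: principal_right_ideal_def)
    then show "x \<in> {Bic p q | p q. m \<le> p}"
    proof cases
      case 2
      then show ?thesis by (cases q) auto
    qed auto
  next
    fix x assume "x \<in> {Bic p q | p q. m \<le> p}"
    then obtain p q where x: "x = Bic p q" "m \<le> p" by auto
    then have "x = Bic m n * Bic (n + (p - m)) q"
      by (simp add: max_absorb2 del: add_diff_assoc)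
    then show "x \<in> principal_right_ideal (Bic m n)"
      unfolding principal_right_ideal_def by blast
  qed
  have "i = k" if "{Bic p q | p q. i \<le> p} = {Bic p q | p q. k \<le> p}"
  proof -
    have "Bic i 0 \<in> {Bic p q | p q. k \<le> p}" by (subst that[symmetric]) blast
    moreover have "Bic k 0 \<in> {Bic p q | p q. i \<le> p}" by (subst that) blast
    ultimately show ?thesis by simp
  qed
  then show ?thesis
    unfolding green_R_def ideal by blast
qed

definition bic_a :: bicyclic where "bic_a = Bic 1 0"

definition bic_b :: bicyclic where "bic_b = Bic 0 1"

lemma Bic_eq_powers: "Bic i j = bic_a ^ i * bic_b ^ j"
proof -
  have "bic_a ^ i = Bic i 0"
    by (induction i) (auto simp: bic_a_def one_bicyclic_def)
  moreover have "bic_b ^ j = Bic 0 j"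
    by (induction j) (auto simp: bic_b_def one_bicyclic_def)
  ultimately show ?thesis by simp
qed

lemma bic_b_a: "bic_b * bic_a = 1"
  by (simp add: bic_a_def bic_b_def one_bicyclic_def)

text \<open>The universal property of the presentation $\langle a, b \mid ba = 1\rangle$.\<close>
lemma bicyclic_universal:
  fixes u v :: "'m::monoid_mult"
  assumes "v * u = 1"
  shows "\<exists>!f :: bicyclic \<Rightarrow> 'm.
           f 1 = 1 \<and> (\<forall>x y. f (x * y) = f x * f y) \<and> f bic_a = u \<and> f bic_b = v"
proof (rule ex1I)
  have cancel: "v ^ n * u ^ n = 1" for n
  proof (induction n)
    case (Suc n)
    have "v ^ Suc n * u ^ Suc n = v ^ n * (v * u) * u ^ n"
      unfolding power_Suc2[of v n] power_Suc[of u n] by (simp only: mult.assoc)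
    then show ?case using Suc assms by simp
  qed simp
  have mult: "u ^ k * v ^ l * (u ^ m * v ^ n)
      = u ^ (k + (max l m - l)) * v ^ (n + (max l m - m))" for k l m n
  proof (cases "l \<le> m")
    case True
    then have "u ^ m = u ^ l * u ^ (m - l)" by (simp flip: power_add)
    then have "u ^ k * v ^ l * (u ^ m * v ^ n)
        = u ^ k * (v ^ l * u ^ l) * u ^ (m - l) * v ^ n"
      by (simp only: mult.assoc)
    then show ?thesis using True by (simp add: cancel power_add max_absorb2 del: add_diff_assoc)
  next
    case False
    then have "v ^ l = v ^ (l - m) * v ^ m" by (simp flip: power_add)
    then have "u ^ k * v ^ l * (u ^ m * v ^ n)
        = u ^ k * v ^ (l - m) * (v ^ m * u ^ m) * v ^ n"
      by (simp only: mult.assoc)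
    then have "\<dots> = u ^ k * v ^ (l - m + n)"
      by (simp add: cancel power_add mult.assoc)
    with \<open>u ^ k * v ^ l * (u ^ m * v ^ n) = _\<close> show ?thesis
      using False by (simp add: max_def add.commute)
  qed
  let ?f = "case_bicyclic (\<lambda>i j. u ^ i * v ^ j)"
  have "?f (x * y) = ?f x * ?f y" for x y
    by (cases x; cases y) (simp add: mult)
  then show "?f 1 = 1 \<and> (\<forall>x y. ?f (x * y) = ?f x * ?f y) \<and> ?f bic_a = u \<and> ?f bic_b = v"
    by (simp add: one_bicyclic_def bic_a_def bic_b_def)
next
  fix f :: "bicyclic \<Rightarrow> 'm"
  assume f: "f 1 = 1 \<and> (\<forall>x y. f (x * y) = f x * f y) \<and> f bic_a = u \<and> f bic_b = v"
  have pow: "f (x ^ n) = f x ^ n" for x n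
    using f by (induction n) auto
  have "f (Bic i j) = u ^ i * v ^ j" for i j
    unfolding Bic_eq_powers using f by (simp add: pow)
  then show "f = case_bicyclic (\<lambda>i j. u ^ i * v ^ j)"
    by (auto simp: fun_eq_iff split: bicyclic.split)
qed

end

theory Submission
  imports Defs
begin

text \<open>Comparing \<open>(p, p)\<close> with a product \<open>s\<^sup>-\<^sup>1 t\<close> shows that a left I-order meets every
  \<open>\<L>\<close>-class \<open>{Bic m p | m. True}\<close>. If now \<open>q = s\<^sup>-\<^sup>1 t\<close> with \<open>s\<close>, \<open>t\<close> in rows \<open>i\<close>, \<open>k\<close>, choose
  \<open>u = Bic m (max i k)\<close> in \<open>S\<close>; then \<open>u s\<close> and \<open>u t\<close> both lie in row \<open>m\<close> and
  \<open>(u s)\<^sup>-\<^sup>1 (u t) = s\<^sup>-\<^sup>1 t\<close>.\<close>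

lemma left_I_order_meets_column:
  assumes "left_I_order S"
  obtains m where "Bic m p \<in> S"
proof -
  obtain s t where "s \<in> S" "t \<in> S" and eq: "Bic p p = semigroup_inv s * t"
    using assms unfolding left_I_order_def by blast
  obtain i j k l where "s = Bic i j" "t = Bic k l"
    by (cases s; cases t)
  \<comment> \<open>The product is \<open>Bic (j + (max i k - i)) (l + (max i k - k))\<close>, and
    one of the two differences is 0.\<close>
  with eq have "j = p \<or> l = p"
    by (auto simp: max_def split: if_splits)
  then show thesis
    using \<open>s \<in> S\<close> \<open>t \<in> S\<close> \<open>s = Bic i j\<close> \<open>t = Bic k l\<close> that by blast
qed

theorem theorem1p1:
  fixes S :: "bicyclic set"
  assumes "subsemigroup S"
    and "left_I_order S"
  shows "straight_left_I_order S"
  unfolding straight_left_I_order_def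
proof (intro conjI allI)
  fix q
  obtain s t where st: "s \<in> S" "t \<in> S" and q: "q = semigroup_inv s * t"
    using assms(2) unfolding left_I_order_def by blast
  obtain i j k l where s: "s = Bic i j" and t: "t = Bic k l"
    by (cases s; cases t)
  obtain m where u: "Bic m (max i k) \<in> S"
    using left_I_order_meets_column[OF assms(2)] .
  let ?u = "Bic m (max i k)"
  have "?u * s \<in> S" "?u * t \<in> S"
    using assms(1) u st unfolding subsemigroup_def by blast+
  \<comment> \<open>As \<open>max i k\<close> is at least \<open>i\<close> and \<open>k\<close>, the
    first exponent stays \<open>m\<close> in both products.\<close>
  moreover have us: "?u * s = Bic m (j + (max i k - i))"
    and ut: "?u * t = Bic m (l + (max i k - k))"
    by (simp_all add: s t max_def)
  moreover have "green_R (?u * s) (?u * t)"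
    unfolding us ut by simp
  \<comment> \<open>The inner exponents are both \<open>m\<close> and cancel, leaving exactly the
    normal form of \<open>semigroup_inv s * t\<close>.\<close>
  moreover have "q = semigroup_inv (?u * s) * (?u * t)"
    unfolding us ut by (simp add: q s t)
  ultimately show "\<exists>s\<in>S. \<exists>t\<in>S. green_R s t \<and> q = semigroup_inv s * t"
    by blast
qed (fact assms(1))

end
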